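(* Fix $\alpha_0\in(0,1)$, $\beta\in(\tfrac12,1)$ and $r\in(0,1)$ with $r>\rho^*(\beta)$, where $$\rho^*(\beta)=\begin{cases}\beta-\tfrac12,& \tfrac12<\beta\le\tfrac34,\\ (1-\sqrt{1-\beta})^2,& \tfrac34<\beta<1.\end{cases}$$ Let $\varepsilon_n=n^{-\beta}$ and $\mu_n=\sqrt{2r\log(n)}$. Consider the higher criticism test that rejects $H_0$ when $\mathrm{HC}_n^*>h(n,\alpha_n)$, where the levels $\alpha_n\to0$ slowly enough. Then the test has asymptotically full power: $$P_{H_1^{(n)}}\{\mathrm{HC}_n^*>h(n,\alpha_n)\}\to 1,\qquad n\to\infty .$$
   Context: Hypotheses: under $H_0$, $X_1,\dots,X_n$ are i.i.d. $N(0,1)$; under $H_1^{(n)}$, $X_1,\dots,X_n$ are i.i.d. from the mixture $(1-\varepsilon_n)N(0,1)+\varepsilon_nN(\mu_n,1)$. Let $p_i=P\{N(0,1)>X_i\}$ be the $p$-values and $p_{(1)}\le\dots\le p_{(n)}$ the sorted $p$-values. For a fixed $\alpha_0\in(0,1)$ the higher criticism statistic is $$\mathrm{HC}_n^*=\max_{1\le i\le \alpha_0 n}\ \frac{\sqrt n\,[\,i/n-p_{(i)}\,]}{\sqrt{p_{(i)}(1-p_{(i)})}} .$$ $h(n,\alpha)$ denotes a critical value of the level-$\alpha$ test, so that $P_{H_0}\{\mathrm{HC}_n^*>h(n,\alpha)\}\le\alpha$. One says that $\alpha_n\to0$ slowly enough if $\alpha_n\to 0$ and $h(n,\alpha_n)=\sqrt{2\log\log(n)}\,(1+o(1))$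 as $n\to\infty$. *)

theory Defs
  imports "HOL-Probability.Probability" "HOL-Library.Landau_Symbols"
begin

definition normal_law :: "real \<Rightarrow> real measure" where
  "normal_law \<mu> = density lborel (\<lambda>x. ennreal (normal_density \<mu> 1 x))"

definition mixture_law :: "real \<Rightarrow> real \<Rightarrow> real measure" where
  "mixture_law \<epsilon> \<mu> =
     density lborel (\<lambda>x. ennreal ((1 - \<epsilon>) * normal_density 0 1 x + \<epsilon> * normal_density \<mu> 1 x))"

text \<open>The joint law of an i.i.d. sample of size \<open>n\<close>; a sample point \<open>x\<close> has the
  observations \<open>x 1, \<dots>, x n\<close>.\<close>

definition iid_law :: "nat \<Rightarrow> real measure \<Rightarrow> (nat \<Rightarrow> real) measure" where
  "iid_law n M = PiM {1..n} (\<lambda>_. M)"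

definition null_law :: "nat \<Rightarrow> (nat \<Rightarrow> real) measure" where
  "null_law n = iid_law n (normal_law 0)"

definition alt_law :: "nat \<Rightarrow> real \<Rightarrow> real \<Rightarrow> (nat \<Rightarrow> real) measure" where
  "alt_law n \<epsilon> \<mu> = iid_law n (mixture_law \<epsilon> \<mu>)"

definition p_value :: "real \<Rightarrow> real" where
  "p_value t = measure (normal_law 0) {t<..}"

definition sorted_p_value :: "nat \<Rightarrow> (nat \<Rightarrow> real) \<Rightarrow> nat \<Rightarrow> real" where
  "sorted_p_value n x i = sort (map (\<lambda>j. p_value (x j)) [1..<Suc n]) ! (i - 1)"

text \<open>The maximum is over a nonempty set only if \<open>\<alpha>\<^sub>0 n \<ge> 1\<close>; for smaller \<open>n\<close> the value is
  an unspecified constant. No denominator vanishes, because \<open>0 < p_value t < 1\<close> for every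
  real \<open>t\<close>.\<close>

definition HC :: "real \<Rightarrow> nat \<Rightarrow> (nat \<Rightarrow> real) \<Rightarrow> real" where
  "HC \<alpha>\<^sub>0 n x =
     Max ((\<lambda>i. sqrt (real n) * (real i / real n - sorted_p_value n x i) /
               sqrt (sorted_p_value n x i * (1 - sorted_p_value n x i)))
          ` {i. 1 \<le> i \<and> real i \<le> \<alpha>\<^sub>0 * real n})"

definition rejection_prob :: "(nat \<Rightarrow> real) measure \<Rightarrow> real \<Rightarrow> nat \<Rightarrow> real \<Rightarrow> real" where
  "rejection_prob P \<alpha>\<^sub>0 n c = measure P {x \<in> space P. HC \<alpha>\<^sub>0 n x > c}"

definition critical_values :: "real \<Rightarrow> (nat \<Rightarrow> real \<Rightarrow> real) \<Rightarrow> bool" where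
  "critical_values \<alpha>\<^sub>0 h \<longleftrightarrow>
     (\<forall>n \<alpha>. 1 \<le> \<alpha>\<^sub>0 * real n \<longrightarrow> 0 < \<alpha> \<longrightarrow> \<alpha> < 1 \<longrightarrow>
        rejection_prob (null_law n) \<alpha>\<^sub>0 n (h n \<alpha>) \<le> \<alpha>)"

definition slowly_enough :: "(nat \<Rightarrow> real \<Rightarrow> real) \<Rightarrow> (nat \<Rightarrow> real) \<Rightarrow> bool" where
  "slowly_enough h \<alpha> \<longleftrightarrow>
     \<alpha> \<longlonglongrightarrow> 0 \<and>
     (\<lambda>n. h n (\<alpha> n)) \<sim>[at_top] (\<lambda>n. sqrt (2 * ln (ln (real n))))"

text \<open>The detection boundary; relevant for \<open>1/2 < \<beta> < 1\<close>.\<close>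

definition rho_star :: "real \<Rightarrow> real" where
  "rho_star \<beta> = (if \<beta> \<le> 3/4 then \<beta> - 1/2 else (1 - sqrt (1 - \<beta>))\<^sup>2)"

end

theory Submission
  imports Defs "HOL-Real_Asymp.Real_Asymp"
begin

text \<open>
  Fix the threshold \<open>t = \<xi> sqrt (2 ln n)\<close> with \<open>\<xi> = min (2 sqrt r) 1\<close>, let \<open>N\<close> be the number of
  observations above \<open>t\<close>, and let \<open>p\<close> and \<open>Q\<close> be the probabilities of exceeding \<open>t\<close> under the
  null and under the mixture. If \<open>np < N \<le> \<alpha>\<^sub>0 n\<close>, the \<open>N\<close>-th smallest \<open>p\<close>-value is at most \<open>p\<close>, so
  \<open>HC \<ge> (N - np) / sqrt (np)\<close>. Up to subpolynomial factors, \<open>np\<close> is at most \<open>n\<close> to the power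
  \<open>1 - \<xi>\<^sup>2\<close> and the excess \<open>n (Q - p)\<close> of the mean is at least \<open>n\<close> to the power
  \<open>1 - \<beta> - (\<xi> - sqrt r)\<^sup>2\<close>. This \<open>\<xi>\<close> maximises the second exponent minus half the first over
  \<open>sqrt r \<le> \<xi> \<le> 1\<close>, and the maximum is positive exactly above the detection boundary. Hence the
  excess dominates both \<open>ln n sqrt (np)\<close>, which eventually exceeds the critical value times
  \<open>sqrt (np)\<close>, and the standard deviation of \<open>N\<close>; Chebyshev's inequality finishes the proof.
\<close>

section \<open>The normal law and the two-component mixture\<close>

lemma prob_space_normal_law: "prob_space (normal_law \<mu>)"
  unfolding normal_law_def by (rule prob_space_normal_density) simp

lemma sets_normal_law [measurable_cong]: "sets (normal_law \<mu>) = sets borel"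
  by (simp add: normal_law_def)

lemma sets_mixture_law [measurable_cong]: "sets (mixture_law \<epsilon> \<mu>) = sets borel"
  by (simp add: mixture_law_def)

lemma emeasure_mixture_law:
  assumes "0 \<le> \<epsilon>" "\<epsilon> \<le> 1" and [measurable]: "A \<in> sets borel"
  shows "emeasure (mixture_law \<epsilon> \<mu>) A =
    ennreal (1 - \<epsilon>) * emeasure (normal_law 0) A + ennreal \<epsilon> * emeasure (normal_law \<mu>) A"
proof -
  have "emeasure (mixture_law \<epsilon> \<mu>) A =
    (\<integral>\<^sup>+ x. ennreal (1 - \<epsilon>) * (ennreal (normal_density 0 1 x) * indicator A x) +
      ennreal \<epsilon> * (ennreal (normal_density \<mu> 1 x) * indicator A x) \<partial>lborel)"
    unfolding mixture_law_def using assms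
    by (subst emeasure_density)
       (auto intro!: nn_integral_cong simp: ennreal_mult' distrib_right mult.assoc)
  also have "\<dots> = ennreal (1 - \<epsilon>) * emeasure (normal_law 0) A + ennreal \<epsilon> * emeasure (normal_law \<mu>) A"
    unfolding normal_law_def
    by (subst nn_integral_add) (auto simp: nn_integral_cmult emeasure_density)
  finally show ?thesis .
qed

lemma prob_space_mixture_law:
  assumes "0 \<le> \<epsilon>" "\<epsilon> \<le> 1"
  shows "prob_space (mixture_law \<epsilon> \<mu>)"
proof
  have "emeasure (normal_law m) UNIV = 1" for m
    using prob_space.emeasure_space_1[OF prob_space_normal_law, of m] by (simp add: normal_law_def)
  then show "emeasure (mixture_law \<epsilon> \<mu>) (space (mixture_law \<epsilon> \<mu>)) = 1"
    using emeasure_mixture_law[OF assms, of UNIV \<mu>] assms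
    by (simp add: mixture_law_def flip: ennreal_plus)
qed

lemma measure_mixture_law:
  assumes "0 \<le> \<epsilon>" "\<epsilon> \<le> 1" "A \<in> sets borel"
  shows "measure (mixture_law \<epsilon> \<mu>) A =
    (1 - \<epsilon>) * measure (normal_law 0) A + \<epsilon> * measure (normal_law \<mu>) A"
proof -
  interpret N: prob_space "normal_law m" for m by (rule prob_space_normal_law)
  interpret X: prob_space "mixture_law \<epsilon> \<mu>" by (rule prob_space_mixture_law) fact+
  have "ennreal (measure (mixture_law \<epsilon> \<mu>) A) =
    ennreal ((1 - \<epsilon>) * measure (normal_law 0) A + \<epsilon> * measure (normal_law \<mu>) A)"
    using emeasure_mixture_law[OF assms, of \<mu>] assms
    by (simp add: N.emeasure_eq_measure X.emeasure_eq_measure ennreal_mult)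
  then show ?thesis
    using assms by (subst (asm) ennreal_inj) auto
qed

section \<open>Gaussian tail bounds and the p-value function\<close>

lemma normal_law_tail_ge:
  assumes "\<mu> \<le> t"
  shows "measure (normal_law \<mu>) {t<..} \<ge> normal_density \<mu> 1 (t + 1)"
proof -
  interpret prob_space "normal_law \<mu>" by (rule prob_space_normal_law)
  \<comment> \<open>To the right of the mean the density decreases, so on an interval of length 1
    its value at the right endpoint already bounds the mass from below.\<close>
  have le: "normal_density \<mu> 1 (t + 1) \<le> normal_density \<mu> 1 y" if "y \<in> {t<..t+1}" for y
    unfolding normal_density_def using that assms
    by (intro mult_left_mono) (auto intro!: power_mono)
  have "ennreal (normal_density \<mu> 1 (t + 1)) =
      (\<integral>\<^sup>+ y. ennreal (normal_density \<mu> 1 (t + 1)) * indicator {t<..t+1} y \<partial>lborel)"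
    by (simp add: nn_integral_cmult_indicator)
  also have "\<dots> \<le> (\<integral>\<^sup>+ y. ennreal (normal_density \<mu> 1 y) * indicator {t<..} y \<partial>lborel)"
    using le by (intro nn_integral_mono) (auto simp: indicator_def intro!: ennreal_leI)
  also have "\<dots> = emeasure (normal_law \<mu>) {t<..}"
    unfolding normal_law_def by (subst emeasure_density) auto
  finally show ?thesis
    by (simp add: emeasure_eq_measure)
qed

text \<open>Change of measure: beyond \<open>t\<close> the standard density is at most
  \<open>exp (- t\<^sup>2 / 2)\<close> times the density centred at \<open>t\<close>, and the latter
  has total mass 1.\<close>

lemma p_value_le_exp:
  assumes "0 \<le> t"
  shows "p_value t \<le> exp (- t\<^sup>2 / 2)"
proof -
  interpret prob_space "normal_law m" for m by (rule prob_space_normal_law)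
  have le: "normal_density 0 1 y \<le> exp (- t\<^sup>2 / 2) * normal_density t 1 y" if "t < y" for y
  proof -
    have "t * t \<le> t * y" using that assms by (intro mult_left_mono) auto
    then have "- y\<^sup>2 / 2 \<le> - t\<^sup>2 / 2 - (y - t)\<^sup>2 / 2"
      by (simp add: power2_eq_square field_simps)
    then have "exp (- y\<^sup>2 / 2) \<le> exp (- t\<^sup>2 / 2) * exp (- (y - t)\<^sup>2 / 2)"
      by (simp flip: exp_add)
    from divide_right_mono[OF this, of "sqrt (2 * pi)"] show ?thesis
      by (simp add: normal_density_def)
  qed
  have "emeasure (normal_law 0) {t<..} = (\<integral>\<^sup>+ y. ennreal (normal_density 0 1 y) * indicator {t<..} y \<partial>lborel)"
    unfolding normal_law_def by (subst emeasure_density) auto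
  also have "\<dots> \<le> (\<integral>\<^sup>+ y. ennreal (exp (- t\<^sup>2 / 2)) * ennreal (normal_density t 1 y) * indicator {t<..} y \<partial>lborel)"
    using le by (intro nn_integral_mono) (auto simp: indicator_def simp flip: ennreal_mult intro!: ennreal_leI)
  also have "\<dots> = ennreal (exp (- t\<^sup>2 / 2)) * emeasure (normal_law t) {t<..}"
    unfolding normal_law_def by (subst emeasure_density) (auto simp: nn_integral_cmult mult.assoc)
  also have "\<dots> \<le> ennreal (exp (- t\<^sup>2 / 2)) * 1"
    by (intro mult_left_mono emeasure_le_1) auto
  finally show ?thesis
    by (simp add: emeasure_eq_measure p_value_def)
qed

lemma p_value_pos: "0 < p_value t"
proof -
  interpret N: prob_space "normal_law 0" by (rule prob_space_normal_law)
  have "0 < normal_density 0 1 (max 0 t + 1)" by (rule normal_density_pos) simp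
  also have "\<dots> \<le> p_value (max 0 t)"
    unfolding p_value_def by (rule normal_law_tail_ge) simp
  also have "\<dots> \<le> p_value t"
    unfolding p_value_def by (intro N.finite_measure_mono) (auto simp: sets_normal_law)
  finally show ?thesis .
qed

lemma antimono_p_value: "antimono p_value"
proof
  fix s t :: real assume "s \<le> t"
  interpret N: prob_space "normal_law 0" by (rule prob_space_normal_law)
  show "p_value t \<le> p_value s"
    unfolding p_value_def using \<open>s \<le> t\<close>
    by (intro N.finite_measure_mono) (auto simp: sets_normal_law)
qed

lemma borel_measurable_p_value [measurable]: "p_value \<in> borel_measurable borel"
proof -
  have "(\<lambda>t. - p_value t) \<in> borel_measurable borel"
    using antimono_p_value by (intro borel_measurable_mono) (auto simp: mono_def antimono_def)
  then show ?thesis by simp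
qed

section \<open>Order statistics as counts, and measurability of the statistic\<close>

lemma sorted_nth_le_iff:
  fixes u :: "'a :: linorder"
  assumes "sorted xs" "k < length xs"
  shows "xs ! k \<le> u \<longleftrightarrow> k < length (filter (\<lambda>y. y \<le> u) xs)"
  using assms
proof (induction xs arbitrary: k)
  case (Cons a xs)
  show ?case
  proof (cases "a \<le> u")
    case True
    then show ?thesis using Cons by (cases k) auto
  next
    case False
    \<comment> \<open>Entries at most \<open>u\<close> form a prefix of a sorted list: once the head
      exceeds \<open>u\<close>, so does everything after it.\<close>
    then have "\<not> y \<le> u" if "y \<in> set xs" for y
      using that Cons.prems by auto
    then show ?thesis using False Cons.prems by (cases k) (auto simp: filter_empty_conv)
  qed
qed simp

lemma sort_nth_le_iff:
  fixes u :: "'a :: linorder"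
  assumes "k < length xs"
  shows "sort xs ! k \<le> u \<longleftrightarrow> k < length (filter (\<lambda>y. y \<le> u) xs)"
proof -
  have "length (filter (\<lambda>y. y \<le> u) (sort xs)) = length (filter (\<lambda>y. y \<le> u) xs)"
    by (metis mset_filter mset_sort size_mset)
  then show ?thesis using sorted_nth_le_iff[of "sort xs" k u] assms by simp
qed

text \<open>Trades an order statistic for a count. This serves both measurability and the upper
  bound on the \<open>N\<close>-th smallest p-value.\<close>

lemma sorted_p_value_le_iff:
  assumes "1 \<le> i" "i \<le> n"
  shows "sorted_p_value n x i \<le> u \<longleftrightarrow> i \<le> card {j \<in> {1..n}. p_value (x j) \<le> u}"
proof -
  have "length (filter (\<lambda>y. y \<le> u) (map (\<lambda>j. p_value (x j)) [1..<Suc n])) =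
      card {j \<in> {1..n}. p_value (x j) \<le> u}"
    using distinct_card[of "filter (\<lambda>j. p_value (x j) \<le> u) [1..<Suc n]"]
    by (simp add: filter_map o_def atLeastLessThanSuc_atLeastAtMost del: upt_Suc)
  then show ?thesis
    unfolding sorted_p_value_def using assms by (subst sort_nth_le_iff) auto
qed

lemma sorted_p_value_pos:
  assumes "1 \<le> i" "i \<le> n"
  shows "0 < sorted_p_value n x i"
proof -
  have "sorted_p_value n x i \<in> set (sort (map (\<lambda>j. p_value (x j)) [1..<Suc n]))"
    unfolding sorted_p_value_def using assms by (intro nth_mem) auto
  then show ?thesis by (auto simp: p_value_pos simp del: upt_Suc)
qed

lemma real_card_eq_sum_indicator:
  assumes "finite I"
  shows "real (card {j \<in> I. x j \<in> A}) = (\<Sum>j\<in>I. indicator A (x j))"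
proof -
  have "(\<Sum>j\<in>I. indicator A (x j) :: real) = (\<Sum>j\<in>{j \<in> I. x j \<in> A}. 1)"
    using assms by (intro sum.mono_neutral_cong_right) (auto simp: indicator_def)
  then show ?thesis by simp
qed

text \<open>The preimage of a half-line is a condition on a count, and the count is a sum of
  measurable indicators of the coordinates.\<close>

lemma borel_measurable_sorted_p_value:
  assumes [measurable_cong]: "sets M = sets borel" and i: "1 \<le> i" "i \<le> n"
  shows "(\<lambda>x. sorted_p_value n x i) \<in> borel_measurable (iid_law n M)"
proof (rule borel_measurableI_le)
  fix u :: real
  have [measurable]: "(\<lambda>x. \<Sum>j=1..n. indicator {y. p_value y \<le> u} (x j) :: real) \<in> borel_measurable (iid_law n M)"
    unfolding iid_law_def by measurable
  have "sorted_p_value n x i \<le> u \<longleftrightarrow> real i \<le> (\<Sum>j=1..n. indicator {y. p_value y \<le> u} (x j))" for x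
    using sorted_p_value_le_iff[OF i, of x u] real_card_eq_sum_indicator[of "{1..n}" x "{y. p_value y \<le> u}"]
    by (simp only: mem_Collect_eq of_nat_le_iff finite_atLeastAtMost flip: real_card_eq_sum_indicator)
  then have "{x \<in> space (iid_law n M). sorted_p_value n x i \<le> u} =
    {x \<in> space (iid_law n M). real i \<le> (\<Sum>j=1..n. indicator {y. p_value y \<le> u} (x j))}"
    by simp
  also have "\<dots> \<in> sets (iid_law n M)" by measurable
  finally show "{x \<in> space (iid_law n M). sorted_p_value n x i \<le> u} \<in> sets (iid_law n M)" .
qed

lemma finite_HC_indices: "finite {i. 1 \<le> i \<and> real i \<le> \<alpha>\<^sub>0 * real n}"
  by (rule finite_subset[of _ "{..nat \<lfloor>\<alpha>\<^sub>0 * real n\<rfloor>}"]) (auto simp: le_nat_floor)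

lemma borel_measurable_HC:
  assumes "sets M = sets borel" "0 < \<alpha>\<^sub>0" "\<alpha>\<^sub>0 \<le> 1"
  shows "HC \<alpha>\<^sub>0 n \<in> borel_measurable (iid_law n M)"
proof -
  have [measurable]: "(\<lambda>x. sorted_p_value n x i) \<in> borel_measurable (iid_law n M)"
    if "i \<in> {i. 1 \<le> i \<and> real i \<le> \<alpha>\<^sub>0 * real n}" for i
  proof (rule borel_measurable_sorted_p_value)
    have "real i \<le> 1 * real n"
      using that assms(2,3) by (intro order_trans[OF _ mult_right_mono[of \<alpha>\<^sub>0 1]]) auto
    then show "i \<le> n" by simp
  qed (use that assms in auto)
  show ?thesis
    unfolding HC_def[abs_def] using finite_HC_indices
    by (intro borel_measurable_Max) auto
qed

section \<open>Second moments and deviations of counts under a product law\<close>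

lemma integral_PiM_square_sum:
  fixes g :: "'a \<Rightarrow> real"
  assumes "prob_space M" "finite I" and [measurable]: "g \<in> borel_measurable M"
    and bound: "\<And>y. \<bar>g y\<bar> \<le> B" and mean: "(\<integral>y. g y \<partial>M) = 0"
  shows "(\<integral>x. (\<Sum>j\<in>I. g (x j))\<^sup>2 \<partial>PiM I (\<lambda>_. M)) = real (card I) * (\<integral>y. (g y)\<^sup>2 \<partial>M)"
proof -
  interpret M: prob_space M by fact
  interpret product_sigma_finite "\<lambda>_. M" ..
  interpret P: prob_space "PiM I (\<lambda>_. M)" by (intro prob_space_PiM assms)
  have int: "integrable (PiM I (\<lambda>_. M)) (\<lambda>x. g (x j) * g (x k))" if "j \<in> I" "k \<in> I" for j k
    using that bound
    by (intro P.integrable_const_bound[of _ "B * B"] AE_I2)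
       (auto simp: abs_mult intro!: mult_mono order_trans[OF abs_ge_zero bound])
  have diag: "(\<integral>x. g (x j) * g (x j) \<partial>PiM I (\<lambda>_. M)) = (\<integral>y. (g y)\<^sup>2 \<partial>M)" if "j \<in> I" for j
  proof -
    have "(\<integral>y. (g y)\<^sup>2 \<partial>M) = (\<integral>y. (g y)\<^sup>2 \<partial>distr (PiM I (\<lambda>_. M)) M (\<lambda>x. x j))"
      using that assms by (subst distr_PiM_component) auto
    also have "\<dots> = (\<integral>x. g (x j) * g (x j) \<partial>PiM I (\<lambda>_. M))"
      using that by (subst integral_distr) (auto simp: power2_eq_square)
    finally show ?thesis ..
  qed
  have off: "(\<integral>x. g (x j) * g (x k) \<partial>PiM I (\<lambda>_. M)) = 0" if "j \<in> I" "k \<in> I" "j \<noteq> k" for j k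
  proof -
    \<comment> \<open>Padding with the factor 1 at all other indices makes the mixed term a product
      over \<open>I\<close>, so its integral factorises and picks up the vanishing mean.\<close>
    have prod2: "(\<Prod>i\<in>I. if i \<in> {j, k} then f i else 1) = f j * f k" for f :: "_ \<Rightarrow> real"
    proof -
      have "(\<Prod>i\<in>I. if i \<in> {j, k} then f i else 1) = prod f (I \<inter> {j, k})"
        by (rule prod.inter_restrict[symmetric]) fact
      also have "I \<inter> {j, k} = {j, k}" using that by auto
      finally show ?thesis using that by simp
    qed
    have "integrable M g"
      using bound by (intro M.integrable_const_bound[of _ B]) auto
    then have "(\<integral>x. (\<Prod>i\<in>I. (if i \<in> {j, k} then g else (\<lambda>_. 1)) (x i)) \<partial>PiM I (\<lambda>_. M)) =
        (\<Prod>i\<in>I. \<integral>y. (if i \<in> {j, k} then g else (\<lambda>_. 1)) y \<partial>M)"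
      by (intro product_integral_prod \<open>finite I\<close>) auto
    also have "\<dots> = (\<Prod>i\<in>I. if i \<in> {j, k} then (\<integral>y. g y \<partial>M) else 1)"
      by (intro prod.cong) (auto simp: M.prob_space)
    also have "\<dots> = 0"
      by (subst prod2) (simp add: mean)
    also have "(\<lambda>x. \<Prod>i\<in>I. (if i \<in> {j, k} then g else (\<lambda>_. 1)) (x i)) =
        (\<lambda>x. \<Prod>i\<in>I. if i \<in> {j, k} then g (x i) else 1)"
      by (intro ext prod.cong) auto
    finally show ?thesis by (subst (asm) prod2)
  qed
  have "(\<integral>x. (\<Sum>j\<in>I. g (x j))\<^sup>2 \<partial>PiM I (\<lambda>_. M)) =
      (\<Sum>j\<in>I. \<Sum>k\<in>I. \<integral>x. g (x j) * g (x k) \<partial>PiM I (\<lambda>_. M))"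
    unfolding power2_eq_square sum_product using int by simp
  also have "\<dots> = (\<Sum>j\<in>I. \<Sum>k\<in>I. if k = j then (\<integral>y. (g y)\<^sup>2 \<partial>M) else 0)"
    using diag off by (intro sum.cong refl) auto
  also have "\<dots> = real (card I) * (\<integral>y. (g y)\<^sup>2 \<partial>M)"
    using \<open>finite I\<close> by simp
  finally show ?thesis .
qed

lemma iid_law_count_deviation:
  fixes M :: "real measure"
  assumes "prob_space M" and A: "A \<in> sets M" and "0 < a"
  shows "measure (iid_law n M) {x \<in> space (iid_law n M).
      a \<le> \<bar>(\<Sum>j=1..n. indicator A (x j)) - real n * measure M A\<bar>} \<le> real n * measure M A / a\<^sup>2"
proof -
  interpret M: prob_space M by fact
  interpret P: prob_space "iid_law n M"
    unfolding iid_law_def by (intro prob_space_PiM assms)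
  note [measurable] = A
  define g :: "real \<Rightarrow> real" where "g y = indicator A y - measure M A" for y
  have [measurable]: "g \<in> borel_measurable M"
    unfolding g_def by measurable
  have bound: "\<bar>g y\<bar> \<le> 1" for y
    unfolding g_def using M.prob_le_1[of A] measure_nonneg[of M A]
    by (auto simp: indicator_def simp del: M.prob_le_1)
  have mean: "(\<integral>y. g y \<partial>M) = 0"
    unfolding g_def using A by (simp add: M.prob_space M.emeasure_eq_measure)
  have "(g y)\<^sup>2 = (1 - 2 * measure M A) * indicator A y + (measure M A)\<^sup>2" for y
    unfolding g_def by (auto simp: indicator_def power2_eq_square algebra_simps)
  then have "(\<integral>y. (g y)\<^sup>2 \<partial>M) = (1 - 2 * measure M A) * measure M A + (measure M A)\<^sup>2"
    using A by (simp add: M.prob_space M.emeasure_eq_measure)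
  \<comment> \<open>The left side is the Bernoulli variance \<open>m * (1 - m)\<close> with
    \<open>m = measure M A\<close>.\<close>
  also have "\<dots> \<le> measure M A"
    by (simp add: power2_eq_square algebra_simps)
  finally have var: "(\<integral>y. (g y)\<^sup>2 \<partial>M) \<le> measure M A" .
  let ?S = "\<lambda>x. \<Sum>j=1..n. g (x j)"
  have [measurable]: "?S \<in> borel_measurable (iid_law n M)"
    unfolding iid_law_def by measurable
  \<comment> \<open>Boundedness supplies the integrability of the square that Chebyshev's inequality
    requires.\<close>
  have "\<bar>?S x\<bar> \<le> real n" for x
    using bound sum_bounded_above[of "{1..n}" "\<lambda>j. \<bar>g (x j)\<bar>" 1]
    by (intro order_trans[OF sum_abs]) simp
  then have "\<bar>(?S x)\<^sup>2\<bar> \<le> (real n)\<^sup>2" for x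
    by (simp add: abs_le_square_iff[symmetric])
  then have "integrable (iid_law n M) (\<lambda>x. (?S x)\<^sup>2)"
    by (intro P.integrable_const_bound[of _ "(real n)\<^sup>2"]) (auto simp del: One_nat_def)
  then have "P.prob {x \<in> space (iid_law n M). a \<le> \<bar>?S x\<bar>} \<le> P.expectation (\<lambda>x. (?S x)\<^sup>2) / a\<^sup>2"
    using \<open>0 < a\<close> by (intro P.second_moment_method) (auto simp del: One_nat_def)
  also have "P.expectation (\<lambda>x. (?S x)\<^sup>2) = real n * (\<integral>y. (g y)\<^sup>2 \<partial>M)"
    unfolding iid_law_def using integral_PiM_square_sum[OF \<open>prob_space M\<close> _ _ bound mean, of "{1..n}"]
    by (simp del: One_nat_def)
  also have "\<dots> / a\<^sup>2 \<le> real n * measure M A / a\<^sup>2"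
    using var by (intro divide_right_mono mult_left_mono) auto
  finally show ?thesis
    by (simp add: g_def sum_subtractf)
qed

section \<open>From exceedance counts to rejection\<close>

lemma HC_gt:
  assumes \<alpha>: "0 < \<alpha>\<^sub>0" "\<alpha>\<^sub>0 \<le> 1" and p: "p_value t \<le> 1/2"
    and N: "N = (\<Sum>j=1..n. indicator {t<..} (x j))" "N \<le> \<alpha>\<^sub>0 * real n" "real n * p_value t < N"
    and c: "c * sqrt (real n * p_value t) < N - real n * p_value t"
  shows "c < HC \<alpha>\<^sub>0 n x"
proof -
  define k where "k = card {j \<in> {1..n}. x j \<in> {t<..}}"
  define p where "p = p_value t"
  define u where "u = sorted_p_value n x k"
  have Nk: "N = real k"
    unfolding N k_def by (rule real_card_eq_sum_indicator[symmetric]) simp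
  have "0 < p" unfolding p_def by (rule p_value_pos)
  then have "0 < N" using N(3) by (intro le_less_trans[OF _ N(3)]) (simp add: p_def)
  then have "1 \<le> k" by (simp add: Nk)
  have "N \<le> 1 * real n"
    using N(2) \<alpha> by (elim order_trans) (intro mult_right_mono, auto)
  then have "k \<le> n" by (simp add: Nk)
  then have "0 < real n" using \<open>1 \<le> k\<close> by simp
  have "0 < u" unfolding u_def by (rule sorted_p_value_pos) fact+
  have "k \<le> card {j \<in> {1..n}. p_value (x j) \<le> p}"
    unfolding k_def p_def by (intro card_mono) (auto intro: antimonoD[OF antimono_p_value])
  then have "u \<le> p"
    unfolding u_def using \<open>1 \<le> k\<close> \<open>k \<le> n\<close> by (simp add: sorted_p_value_le_iff)
  \<comment> \<open>The numerator must be positive: replacing \<open>sqrt p\<close> by the smaller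
    \<open>sqrt (u * (1 - u))\<close> enlarges the quotient only then.\<close>
  have kn: "p < real k / real n"
    using N(3) \<open>0 < real n\<close> by (simp add: Nk p_def field_simps)
  have "u * (1 - u) \<le> p * 1"
    using \<open>0 < u\<close> \<open>u \<le> p\<close> p by (intro mult_mono) (auto simp: p_def)
  then have sq: "0 < sqrt (u * (1 - u))" "sqrt (u * (1 - u)) \<le> sqrt p"
    using \<open>0 < u\<close> \<open>u \<le> p\<close> p by (auto simp: p_def)
  have "c * (sqrt (real n) * sqrt p) < real n * (real k / real n - p)"
    using c \<open>0 < real n\<close> by (simp add: Nk p_def real_sqrt_mult right_diff_distrib)
  also have "\<dots> = sqrt (real n) * (sqrt (real n) * (real k / real n - p))"
    by simp
  finally have "c * sqrt p < sqrt (real n) * (real k / real n - p)"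
    using \<open>0 < real n\<close> by (simp add: mult.left_commute)
  then have "c < sqrt (real n) * (real k / real n - p) / sqrt p"
    using \<open>0 < p\<close> by (simp add: field_simps)
  also have "\<dots> \<le> sqrt (real n) * (real k / real n - u) / sqrt (u * (1 - u))"
    using sq \<open>u \<le> p\<close> kn by (intro frac_le mult_left_mono mult_nonneg_nonneg) auto
  \<comment> \<open>The maximum dominates its term at the random index \<open>k\<close>, which is
    admissible because \<open>N \<le> \<alpha>\<^sub>0 * real n\<close>.\<close>
  also have "\<dots> \<le> HC \<alpha>\<^sub>0 n x"
    unfolding HC_def u_def using finite_HC_indices \<open>1 \<le> k\<close> N(2)
    by (intro Max_ge finite_imageI) (auto simp: Nk)
  finally show ?thesis .
qed

text \<open>Chebyshev's inequality is applied with deviation \<open>a\<close> equal to half the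
  excess of the mean count; squaring that half gives the factor 4. Off the exceptional event the
  count still exceeds \<open>n p\<close> by more than \<open>a\<close>, while
  \<open>Q \<le> \<alpha>\<^sub>0 / 2\<close> leaves room to keep it below
  \<open>\<alpha>\<^sub>0 * real n\<close>.\<close>

lemma rejection_prob_ge:
  assumes \<alpha>: "0 < \<alpha>\<^sub>0" "\<alpha>\<^sub>0 \<le> 1" and M: "prob_space M" "sets M = sets borel"
    and p: "p_value t \<le> 1/2"
    and Q: "Q = measure M {t<..}" "p_value t < Q" "Q \<le> \<alpha>\<^sub>0 / 2" and "0 < n"
    and c: "c * sqrt (real n * p_value t) \<le> real n * (Q - p_value t) / 2"
  shows "rejection_prob (iid_law n M) \<alpha>\<^sub>0 n c \<ge> 1 - 4 * real n * Q / (real n * (Q - p_value t))\<^sup>2"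
proof -
  interpret P: prob_space "iid_law n M"
    unfolding iid_law_def by (intro prob_space_PiM assms)
  note [measurable_cong] = M(2)
  have [measurable]: "HC \<alpha>\<^sub>0 n \<in> borel_measurable (iid_law n M)"
    using \<alpha> M by (intro borel_measurable_HC)
  let ?N = "\<lambda>x. \<Sum>j=1..n. indicator {t<..} (x j) :: real"
  have [measurable]: "?N \<in> borel_measurable (iid_law n M)"
    unfolding iid_law_def by measurable
  define a where "a = real n * (Q - p_value t) / 2"
  have "0 < a" using Q \<open>0 < n\<close> by (simp add: a_def)
  let ?B = "{x \<in> space (iid_law n M). a \<le> \<bar>?N x - real n * Q\<bar>}"
  have "space (iid_law n M) - ?B \<subseteq> {x \<in> space (iid_law n M). c < HC \<alpha>\<^sub>0 n x}"
  proof safe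
    fix x assume "x \<in> space (iid_law n M)" "\<not> a \<le> \<bar>?N x - real n * Q\<bar>"
    then have *: "?N x < real n * Q + a" "real n * Q - a < ?N x" by auto
    have "real n * (2 * Q) \<le> real n * \<alpha>\<^sub>0" "0 < real n * p_value t"
      using Q \<open>0 < n\<close> p_value_pos by auto
    then have "2 * (real n * Q) \<le> \<alpha>\<^sub>0 * real n" "0 < real n * p_value t"
      by (simp_all add: mult_ac)
    moreover have "real n * p_value t + a = real n * Q - a"
      by (simp add: a_def field_simps)
    ultimately have "?N x \<le> \<alpha>\<^sub>0 * real n" "real n * p_value t + a < ?N x"
      using * \<open>0 < a\<close> by linarith+
    then show "c < HC \<alpha>\<^sub>0 n x"
      using \<open>0 < a\<close> c by (intro HC_gt[OF \<alpha> p refl]) (auto simp: a_def)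
  qed
  then have "P.prob (space (iid_law n M) - ?B) \<le> rejection_prob (iid_law n M) \<alpha>\<^sub>0 n c"
    unfolding rejection_prob_def by (intro P.finite_measure_mono) auto
  moreover have "P.prob (space (iid_law n M) - ?B) = 1 - P.prob ?B"
    by (intro P.prob_compl) measurable
  moreover have "P.prob ?B \<le> real n * Q / a\<^sup>2"
    using iid_law_count_deviation[OF M(1) _ \<open>0 < a\<close>, of "{t<..}" n] M(2) by (simp add: Q)
  moreover have "real n * Q / a\<^sup>2 = 4 * real n * Q / (real n * (Q - p_value t))\<^sup>2"
    by (simp add: a_def power_divide)
  ultimately show ?thesis by linarith
qed

section \<open>Exponents above the detection boundary, and asymptotic estimates\<close>

lemma threshold_exponent:
  assumes "1/2 < \<beta>" "\<beta> < 1" "0 < r" "r < 1" "rho_star \<beta> < r"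
  defines "\<xi> \<equiv> min (2 * sqrt r) 1"
  shows "sqrt r < \<xi>" "\<xi> \<le> 1" "(1 - \<xi>\<^sup>2) / 2 < 1 - \<beta> - (\<xi> - sqrt r)\<^sup>2"
proof -
  have r: "0 < sqrt r" "sqrt r < 1" "(sqrt r)\<^sup>2 = r" using assms by auto
  show "sqrt r < \<xi>" "\<xi> \<le> 1" using r by (auto simp: \<xi>_def)
  show "(1 - \<xi>\<^sup>2) / 2 < 1 - \<beta> - (\<xi> - sqrt r)\<^sup>2"
  proof (cases "2 * sqrt r \<le> 1")
    case True
    then have "(sqrt r)\<^sup>2 \<le> (1/2)\<^sup>2" using r by (intro power_mono) auto
    then have "r \<le> 1/4" by (simp add: r power2_eq_square)
    \<comment> \<open>The unconstrained maximiser \<open>2 * sqrt r\<close> is used only for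
      \<open>r \<le> 1/4\<close>. For \<open>\<beta> > 3/4\<close> the boundary lies above 1/4, so
      only its linear branch can occur here.\<close>
    have "\<beta> \<le> 3/4"
    proof (rule ccontr)
      assume *: "\<not> \<beta> \<le> 3/4"
      then have "sqrt (1 - \<beta>) < sqrt ((1/2)\<^sup>2)" by (subst real_sqrt_less_iff) (simp add: power2_eq_square)
      then have "(1/2)\<^sup>2 < (1 - sqrt (1 - \<beta>))\<^sup>2" by (intro power_strict_mono) auto
      then show False using * assms \<open>r \<le> 1/4\<close> by (simp add: rho_star_def power2_eq_square)
    qed
    then have "\<beta> - 1/2 < r" using assms by (simp add: rho_star_def)
    moreover have "\<xi> = 2 * sqrt r" using True by (simp add: \<xi>_def)
    ultimately show ?thesis by (simp add: power_mult_distrib r)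
  next
    case False
    then have \<xi>: "\<xi> = 1" by (simp add: \<xi>_def)
    \<comment> \<open>At \<open>\<xi> = 1\<close> the claim is the square of this inequality. On the
      linear branch \<open>sqrt r > 1/2\<close> alone gives it; on the other branch it is the
      boundary condition.\<close>
    have "1 - sqrt r < sqrt (1 - \<beta>)"
    proof (cases "\<beta> \<le> 3/4")
      case True
      then have "sqrt ((1/2)\<^sup>2) \<le> sqrt (1 - \<beta>)" by (subst real_sqrt_le_iff) (simp add: power2_eq_square)
      then show ?thesis using False by simp
    next
      case False
      then have "sqrt ((1 - sqrt (1 - \<beta>))\<^sup>2) < sqrt r"
        using assms by (subst real_sqrt_less_iff) (simp add: rho_star_def)
      then show ?thesis by simp
    qed
    then have "(1 - sqrt r)\<^sup>2 < (sqrt (1 - \<beta>))\<^sup>2"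
      using r by (intro power_strict_mono) auto
    then show ?thesis using assms by (simp add: \<xi>)
  qed
qed

text \<open>At this point the density is \<open>n\<close> to the power \<open>- z\<^sup>2\<close> up
  to constants and a factor \<open>exp (- z * w)\<close> with \<open>w = sqrt (2 * ln n)\<close>;
  the gap \<open>e - z\<^sup>2\<close> absorbs both. The factor 2 leaves room to subtract the null
  tail later.\<close>

lemma eventually_normal_tail_ge:
  assumes "0 < z" "z\<^sup>2 < e"
  shows "\<forall>\<^sub>F n in sequentially. 2 * real n powr (- e) \<le> normal_density 0 1 (z * sqrt (2 * ln (real n)) + 1)"
proof -
  define \<delta> C where "\<delta> = e - z\<^sup>2" and "C = 1/2 + ln (2 * sqrt (2 * pi))"
  have "0 < \<delta>" using assms by (simp add: \<delta>_def)
  have "\<forall>\<^sub>F n in sequentially. 0 \<le> \<delta> * ln (real n) - z * sqrt (2 * ln (real n)) - C"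
    using \<open>0 < \<delta>\<close> \<open>0 < z\<close> by real_asymp
  then show ?thesis using eventually_gt_at_top[of 0]
  proof eventually_elim
    case (elim n)
    define w where "w = sqrt (2 * ln (real n))"
    have w: "w\<^sup>2 = 2 * ln (real n)" unfolding w_def using elim by (intro real_sqrt_pow2) simp
    have "(z * w + 1)\<^sup>2 / 2 = z\<^sup>2 * ln (real n) + z * w + 1/2"
      by (simp add: power2_sum power_mult_distrib w field_simps)
    then have "- e * ln (real n) + ln (2 * sqrt (2 * pi)) \<le> - (z * w + 1)\<^sup>2 / 2"
      using elim(1) by (simp add: \<delta>_def C_def w_def algebra_simps)
    then have "exp (- e * ln (real n) + ln (2 * sqrt (2 * pi))) \<le> exp (- (z * w + 1)\<^sup>2 / 2)"
      by simp
    then have "real n powr (- e) * (2 * sqrt (2 * pi)) \<le> exp (- (z * w + 1)\<^sup>2 / 2)"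
      using elim(2) by (subst (asm) exp_add) (simp add: powr_def)
    then show "2 * real n powr (- e) \<le> normal_density 0 1 (z * sqrt (2 * ln (real n)) + 1)"
      unfolding w_def[symmetric] std_normal_density_def by (simp add: field_simps)
  qed
qed

text \<open>Eventually the critical value is below twice \<open>sqrt (2 * ln (ln n))\<close>. The
  cruder bound \<open>ln n\<close> suffices, since it will be compared with a positive power of
  \<open>n\<close>.\<close>

lemma slowly_enough_le_ln:
  assumes "slowly_enough h \<alpha>"
  shows "\<forall>\<^sub>F n in sequentially. h n (\<alpha> n) \<le> ln (real n)"
proof -
  have "((\<lambda>n. h n (\<alpha> n) / sqrt (2 * ln (ln (real n)))) \<longlongrightarrow> 1) sequentially"
  proof (rule asymp_equivD_strong)
    have "\<forall>\<^sub>F n in sequentially. 0 < sqrt (2 * ln (ln (real n)))" by real_asymp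
    \<comment> \<open>Asymptotic equivalence counts 0/0 as 1, so convergence of the plain quotient
      needs this case excluded.\<close>
    then show "\<forall>\<^sub>F n in sequentially. h n (\<alpha> n) \<noteq> 0 \<or> sqrt (2 * ln (ln (real n))) \<noteq> 0"
      by eventually_elim simp
  qed (use assms in \<open>simp add: slowly_enough_def\<close>)
  then have "\<forall>\<^sub>F n in sequentially. h n (\<alpha> n) / sqrt (2 * ln (ln (real n))) < 2"
    by (rule order_tendstoD) simp
  moreover have "\<forall>\<^sub>F n in sequentially. 0 < sqrt (2 * ln (ln (real n)))" by real_asymp
  moreover have "\<forall>\<^sub>F n in sequentially. 2 * sqrt (2 * ln (ln (real n))) \<le> ln (real n)" by real_asymp
  ultimately show ?thesis
    by eventually_elim (simp only: pos_divide_less_eq)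
qed

theorem theorem1p2:
  fixes \<alpha>\<^sub>0 \<beta> r :: real
    and h :: "nat \<Rightarrow> real \<Rightarrow> real"
    and \<alpha> \<epsilon> \<mu> :: "nat \<Rightarrow> real"
  assumes "0 < \<alpha>\<^sub>0" and "\<alpha>\<^sub>0 < 1"
    and "1/2 < \<beta>" and "\<beta> < 1"
    and "0 < r" and "r < 1"
    and "rho_star \<beta> < r"
    and "\<And>n. \<epsilon> n = real n powr (- \<beta>)"
    and "\<And>n. \<mu> n = sqrt (2 * r * ln (real n))"
    and "critical_values \<alpha>\<^sub>0 h"
    and "\<And>n. 0 < \<alpha> n \<and> \<alpha> n < 1"
    and "slowly_enough h \<alpha>"
  shows "(\<lambda>n. rejection_prob (alt_law n (\<epsilon> n) (\<mu> n)) \<alpha>\<^sub>0 n (h n (\<alpha> n))) \<longlonglongrightarrow> 1"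
proof -
  define \<xi> where "\<xi> = min (2 * sqrt r) 1"
  define z where "z = \<xi> - sqrt r"
  define q where "q = \<xi>\<^sup>2"
  \<comment> \<open>\<open>l\<close> is the exponent bounding \<open>sqrt (n p)\<close>. Taking
    \<open>e\<close> as the midpoint of \<open>z\<^sup>2\<close> and \<open>1 - \<beta> - l\<close>
    leaves slack on both sides: \<open>z\<^sup>2 < e\<close> for the tail estimate, and
    \<open>l < \<kappa>\<close> for the exponent \<open>\<kappa>\<close> of the excess
    \<open>n (Q - p)\<close>.\<close>
  define l where "l = (1 - q) / 2"
  define e where "e = (z\<^sup>2 + (1 - \<beta> - l)) / 2"
  define \<kappa> where "\<kappa> = 1 - \<beta> - e"
  have \<xi>: "sqrt r < \<xi>" "\<xi> \<le> 1" "l < 1 - \<beta> - z\<^sup>2"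
    using threshold_exponent[OF assms(3-7)] by (simp_all add: \<xi>_def l_def q_def z_def)
  have "0 < sqrt r" using assms(5) by simp
  then have "0 < \<xi>" "0 < z" using \<xi>(1) by (linarith, simp add: z_def)
  then have "0 < q" "q \<le> 1" using \<xi>(2) by (auto simp: q_def power_le_one)
  then have "0 \<le> l" by (simp add: l_def)
  \<comment> \<open>The last inequality follows from
    \<open>e < 1 - \<beta> - l = 1/2 - \<beta> + q/2\<close> and
    \<open>\<beta> > 1/2\<close>.\<close>
  have "z\<^sup>2 < e" "l < \<kappa>" "e \<le> q"
    using \<xi>(3) assms(3) \<open>0 < q\<close> by (simp_all add: e_def \<kappa>_def l_def field_simps)
  define t where "t n = \<xi> * sqrt (2 * ln (real n))" for n :: nat
  define p where "p n = p_value (t n)" for n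
  define Q where "Q n = measure (mixture_law (\<epsilon> n) (\<mu> n)) {t n<..}" for n
  \<comment> \<open>With \<open>s = n (Q - p)\<close>, the Chebyshev error
    \<open>4 n Q / s\<^sup>2\<close> splits into \<open>4 (n p / s\<^sup>2 + 1 / s)\<close>; the
    bounds on \<open>n p\<close> and \<open>s\<close> then give this expression.\<close>
  define err where "err n = 4 * (real n powr (2 * l) / real n powr (2 * \<kappa>) + 1 / real n powr \<kappa>)" for n :: nat
  have "\<forall>\<^sub>F n in sequentially. 1 - err n \<le>
      rejection_prob (alt_law n (\<epsilon> n) (\<mu> n)) \<alpha>\<^sub>0 n (h n (\<alpha> n))"
  proof -
    have ev1: "\<forall>\<^sub>F n in sequentially. real n powr - q \<le> 1/2"
      using \<open>0 < q\<close> by real_asymp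
    have "0 < \<beta>" using assms(3) by simp
    \<comment> \<open>The two terms bound \<open>p\<close> and \<open>\<epsilon>\<close>, and
      \<open>Q \<le> p + \<epsilon>\<close>.\<close>
    then have "(\<lambda>n. real n powr - q + real n powr - \<beta>) \<longlonglongrightarrow> 0"
      using \<open>0 < q\<close> by (intro tendsto_add_zero) real_asymp+
    then have ev2: "\<forall>\<^sub>F n in sequentially. real n powr - q + real n powr - \<beta> < \<alpha>\<^sub>0 / 2"
      by (rule order_tendstoD) (simp add: assms(1))
    have ev3: "\<forall>\<^sub>F n in sequentially. ln (real n) * real n powr l \<le> real n powr \<kappa> / 2"
      using \<open>l < \<kappa>\<close> by real_asymp
    show ?thesis
      using ev1 ev2 ev3 eventually_normal_tail_ge[OF \<open>0 < z\<close> \<open>z\<^sup>2 < e\<close>]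
        slowly_enough_le_ln[OF assms(12)] eventually_gt_at_top[of 0]
    proof eventually_elim
      case (elim n)
      have n: "1 \<le> real n" using elim(6) by simp
      have \<epsilon>: "0 \<le> \<epsilon> n" "\<epsilon> n \<le> 1" "0 < \<epsilon> n"
        using n assms(3) powr_mono[of "-\<beta>" 0 "real n"] by (auto simp: assms(8))
      interpret M: prob_space "mixture_law (\<epsilon> n) (\<mu> n)"
        by (rule prob_space_mixture_law) fact+
      interpret N: prob_space "normal_law (\<mu> n)" by (rule prob_space_normal_law)
      define P where "P = measure (normal_law (\<mu> n)) {t n<..}"
      have \<mu>: "\<mu> n = sqrt r * sqrt (2 * ln (real n))"
        by (simp add: assms(9) mult_ac flip: real_sqrt_mult)
      have t\<mu>: "t n - \<mu> n = z * sqrt (2 * ln (real n))"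
        by (simp add: t_def \<mu> z_def algebra_simps)
      have "0 \<le> t n" "\<mu> n \<le> t n"
        using n \<open>0 < \<xi>\<close> t\<mu> \<open>0 < z\<close> by (auto simp: t_def intro: iffD1[OF diff_ge_0_iff_ge])
      have "(t n)\<^sup>2 / 2 = q * ln (real n)"
        using n by (simp add: t_def q_def power_mult_distrib)
      then have p_le: "p n \<le> real n powr - q"
        using p_value_le_exp[OF \<open>0 \<le> t n\<close>] n by (simp add: p_def powr_def)
      have "2 * real n powr - e \<le> normal_density 0 1 (t n - \<mu> n + 1)"
        using elim(4) by (simp add: t\<mu>)
      also have "\<dots> = normal_density (\<mu> n) 1 (t n + 1)"
        by (simp add: normal_density_def algebra_simps)
      also have "\<dots> \<le> P"
        unfolding P_def by (rule normal_law_tail_ge) fact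
      finally have P_ge: "2 * real n powr - e \<le> P" .
      \<comment> \<open>The null tail costs at most one of the two copies of
        \<open>real n powr - e\<close> in \<open>P_ge\<close>.\<close>
      have "real n powr - q \<le> real n powr - e"
        using n \<open>e \<le> q\<close> by (intro powr_mono) auto
      with p_le P_ge have "real n powr - e \<le> P - p n" by simp
      have Q_eq: "Q n = p n + \<epsilon> n * (P - p n)"
        unfolding Q_def p_def p_value_def P_def
        by (subst measure_mixture_law) (use \<epsilon> in \<open>auto simp: algebra_simps\<close>)
      define s where "s = real n * (Q n - p n)"
      have "real n powr \<kappa> = real n * (real n powr - \<beta> * real n powr - e)"
        using n by (simp add: \<kappa>_def powr_diff powr_minus powr_add field_simps)
      also have "\<dots> \<le> s"
        unfolding s_def Q_eq using \<open>real n powr - e \<le> P - p n\<close>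
        by (auto simp: assms(8) intro!: mult_left_mono)
      finally have s_ge: "real n powr \<kappa> \<le> s" .
      moreover have "0 < real n powr \<kappa>" using n by simp
      ultimately have "0 < s" by linarith
      then have "p n < Q n" using n by (simp add: s_def zero_less_mult_iff)
      have "real n * p n \<le> real n * real n powr - q"
        using p_le by (rule mult_left_mono) simp
      also have "\<dots> = real n powr (1 + - q)"
        using n by (subst powr_add) simp
      also have "1 + - q = 2 * l" by (simp add: l_def)
      finally have np: "real n * p n \<le> real n powr (2 * l)" .
      have "h n (\<alpha> n) * sqrt (real n * p n) \<le> ln (real n) * sqrt (real n * p n)"
        using elim(5) p_value_pos[of "t n"] by (intro mult_right_mono) (auto simp: p_def)
      also have "\<dots> \<le> ln (real n) * sqrt (real n powr (2 * l))"
        using np n by (intro mult_left_mono real_sqrt_le_mono) auto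
      also have "sqrt (real n powr (2 * l)) = real n powr l"
        by (simp add: powr_half_sqrt[symmetric] powr_powr)
      also have "ln (real n) * real n powr l \<le> s / 2"
        using elim(3) s_ge by simp
      finally have c: "h n (\<alpha> n) * sqrt (real n * p n) \<le> s / 2" .
      have "P \<le> 1" "0 \<le> p n" by (auto simp: P_def p_def p_value_def)
      then have "\<epsilon> n * (P - p n) \<le> \<epsilon> n * 1" using \<epsilon> by (intro mult_left_mono) auto
      then have "Q n \<le> \<alpha>\<^sub>0 / 2" using elim(2) p_le by (simp add: Q_eq assms(8))
      have "1 - 4 * real n * Q n / (real n * (Q n - p_value (t n)))\<^sup>2 \<le>
          rejection_prob (alt_law n (\<epsilon> n) (\<mu> n)) \<alpha>\<^sub>0 n (h n (\<alpha> n))"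
        unfolding alt_law_def
        using assms(1,2) elim(1,6) p_le \<open>p n < Q n\<close> \<open>Q n \<le> \<alpha>\<^sub>0 / 2\<close> c
        by (intro rejection_prob_ge) (auto simp: M.prob_space_axioms sets_mixture_law p_def Q_def s_def)
      moreover have "4 * real n * Q n / (real n * (Q n - p_value (t n)))\<^sup>2 = 4 * (real n * p n / s\<^sup>2 + 1 / s)"
      proof -
        have "real n * Q n = real n * p n + s" by (simp add: s_def algebra_simps)
        then have "4 * real n * Q n / s\<^sup>2 = 4 * ((real n * p n + s) / s\<^sup>2)" by (simp add: mult.assoc)
        also have "\<dots> = 4 * (real n * p n / s\<^sup>2 + 1 / s)"
          using \<open>0 < s\<close> by (simp add: power2_eq_square add_divide_distrib)
        finally show ?thesis by (simp add: s_def p_def)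
      qed
      moreover have "real n * p n / s\<^sup>2 + 1 / s \<le> real n powr (2 * l) / (real n powr \<kappa>)\<^sup>2 + 1 / real n powr \<kappa>"
        using np s_ge n by (intro add_mono frac_le power_mono) auto
      moreover have "(real n powr \<kappa>)\<^sup>2 = real n powr (2 * \<kappa>)"
        by (simp add: power2_eq_square flip: powr_add)
      ultimately show ?case by (simp add: err_def)
    qed
  qed
  moreover have "\<forall>\<^sub>F n in sequentially. rejection_prob (alt_law n (\<epsilon> n) (\<mu> n)) \<alpha>\<^sub>0 n (h n (\<alpha> n)) \<le> 1"
    using eventually_gt_at_top[of 0]
  proof eventually_elim
    case (elim n)
    then have "\<epsilon> n \<le> 1" "0 \<le> \<epsilon> n"
      using assms(3) powr_mono[of "-\<beta>" 0 "real n"] by (auto simp: assms(8))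
    then interpret prob_space "alt_law n (\<epsilon> n) (\<mu> n)"
      unfolding alt_law_def iid_law_def by (intro prob_space_PiM prob_space_mixture_law)
    show ?case unfolding rejection_prob_def by (rule prob_le_1)
  qed
  moreover have "(\<lambda>n. 1 - err n) \<longlonglongrightarrow> 1"
  proof -
    \<comment> \<open>Here \<open>\<xi> \<le> 1\<close> enters: it makes \<open>l\<close>
      nonnegative, so the lower bound on the excess itself diverges, even when
      \<open>\<xi> = 1\<close> and \<open>n p\<close> stays bounded.\<close>
    have "0 < \<kappa>" using \<open>0 \<le> l\<close> \<open>l < \<kappa>\<close> by simp
    then have "(\<lambda>n. 1 / real n powr \<kappa>) \<longlonglongrightarrow> 0" by real_asymp
    moreover have "(\<lambda>n. real n powr (2 * l) / real n powr (2 * \<kappa>)) \<longlonglongrightarrow> 0"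
      using \<open>l < \<kappa>\<close> by real_asymp
    ultimately have "(\<lambda>n. real n powr (2 * l) / real n powr (2 * \<kappa>) + 1 / real n powr \<kappa>) \<longlonglongrightarrow> 0"
      by (intro tendsto_add_zero)
    from tendsto_diff[OF tendsto_const tendsto_mult_right_zero[OF this, of 4], of 1]
    show ?thesis by (simp add: err_def)
  qed
  ultimately show ?thesis
    by (rule tendsto_sandwich[OF _ _ _ tendsto_const])
qed

end
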